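(* Let $p$ be an odd prime, $f$ a positive integer, and $q=p^f$. Then there exists a CURD (with $\lambda=1$) with partition $q^1 2^{\frac{q^2-q}{2}}$ (hence on $q^2$ varieties).
   Context: A pairwise balanced design with index $\lambda$ is a pair $(X,\mathcal B)$ of a finite set $X$ of varieties and a collection $\mathcal B$ of subsets of $X$ (blocks) such that each pair of distinct varieties appears together in exactly $\lambda$ blocks. It is a Class-Uniformly Resolvable Design (CURD) if $\mathcal B$ can be partitioned into sets called parallel classes, each of which contains each variety exactly once, and all parallel classes have the same block sizes (with multiplicity). Partition $q^1 2^{\frac{q^2-q}{2}}$ means that each parallel class consists of exactly one block of size $q$ and $\frac{q^2-q}{2}$ blocks of size $2$. Here $\lambda=1$. *)

theory Defs
  imports
    "HOL-Library.Multiset"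
    "HOL-Library.Disjoint_Sets"
    "HOL-Computational_Algebra.Primes"
begin

(* The blocks form a set.  For index 1 this excludes nothing but repeated blocks with
   fewer than two varieties. *)
definition pairwise_balanced_design :: "nat \<Rightarrow> 'a set \<Rightarrow> 'a set set \<Rightarrow> bool" where
  "pairwise_balanced_design lam X B \<longleftrightarrow>
     finite X \<and> B \<subseteq> Pow X \<and>
     (\<forall>x\<in>X. \<forall>y\<in>X. x \<noteq> y \<longrightarrow> card {b \<in> B. x \<in> b \<and> y \<in> b} = lam)"

definition parallel_class :: "'a set \<Rightarrow> 'a set set \<Rightarrow> bool" where
  "parallel_class X P \<longleftrightarrow> P \<subseteq> Pow X \<and> (\<forall>x\<in>X. \<exists>!b. b \<in> P \<and> x \<in> b)"

(* Only meaningful for finite P, which holds for every class of blocks on a finite X. *)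
definition block_sizes :: "'a set set \<Rightarrow> nat multiset" where
  "block_sizes P = image_mset card (mset_set P)"

(* C is the chosen partition of the blocks into parallel classes. *)
definition curd :: "nat \<Rightarrow> 'a set \<Rightarrow> 'a set set \<Rightarrow> 'a set set set \<Rightarrow> bool" where
  "curd lam X B C \<longleftrightarrow>
     pairwise_balanced_design lam X B \<and>
     partition_on B C \<and>
     (\<forall>P\<in>C. parallel_class X P) \<and>
     (\<forall>P\<in>C. \<forall>Q\<in>C. block_sizes P = block_sizes Q)"

definition has_class_partition :: "'a set set set \<Rightarrow> nat multiset \<Rightarrow> bool" where
  "has_class_partition C M \<longleftrightarrow> (\<forall>P\<in>C. block_sizes P = M)"

end

(* Let K be the field with q elements and split the q + 1 directions of the affine plane over K into
   two halves matched by a bijection h.  For every line l with direction d in the first half, the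
   reflection with axis l along h d pairs off the points outside l, so l and these pairs form a
   parallel class.  Two points joined by a direction of the first half lie on a unique axis; two
   points joined by h d are exchanged by exactly one reflection, because their midpoint lies on
   exactly one line of direction d.  Only the class of q + 1 coordinate functions is needed, and
   the midpoint can be taken in the integers modulo the odd number q instead of in K.

   K is a residue field of Z[z], where z is a complex root of unity of order q - 1: modulo a maximal
   ideal containing p, Frobenius gives g(z)^q = g(z^q) = g(z), so every element is congruent to 0
   or a power of z, and these are pairwise incongruent since q - 1 is invertible modulo p. *)
theory Submission
  imports
    Defs
    "HOL-Algebra.Ring_Divisibility"
    "HOL-Number_Theory.Cong"
    "Jordan_Normal_Form.Char_Poly"
begin

hide_const (open) Divisibility.prime

section \<open>Maximal ideals above a proper ideal\<close>

text \<open>Zorn's lemma for the ideals that contain \<open>J\<close> and avoid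
  \<open>\<one>\<close>: both properties survive the union of a nonempty chain. A maximal member is
  a maximal ideal because an ideal containing \<open>\<one>\<close> is the whole ring.\<close>

lemma (in ring) ex_maximalideal_superset:
  assumes "ideal J R" "\<one> \<notin> J"
  shows "\<exists>M. maximalideal M R \<and> J \<subseteq> M"
proof -
  define A where "A = {I. ideal I R \<and> J \<subseteq> I \<and> \<one> \<notin> I}"
  have "\<exists>M\<in>A. \<forall>I\<in>A. M \<subseteq> I \<longrightarrow> I = M"
  proof (rule subset_Zorn_nonempty)
    show "A \<noteq> {}" using assms by (auto simp: A_def)
  next
    fix C assume C: "C \<noteq> {}" "subset.chain A C"
    then have sub: "C \<subseteq> A" by (simp add: pred_on.chain_def)
    have "subset.chain {I. ideal I R} C"
      using C(2) by (auto simp: pred_on.chain_def A_def)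
    from chain_Union_is_ideal[OF this] C(1) have "ideal (\<Union>C) R" by simp
    with sub C(1) show "\<Union>C \<in> A" by (auto simp: A_def)
  qed
  then obtain M where M: "M \<in> A" "\<And>I. I \<in> A \<Longrightarrow> M \<subseteq> I \<Longrightarrow> I = M" by blast
  have "maximalideal M R"
  proof (rule maximalidealI)
    show "ideal M R" "carrier R \<noteq> M" using M(1) by (auto simp: A_def)
    fix I assume I: "ideal I R" "M \<subseteq> I" "I \<subseteq> carrier R"
    show "I = M \<or> I = carrier R"
    proof (cases "\<one> \<in> I")
      case True
      with I show ?thesis using ideal.one_imp_carrier by blast
    next
      case False
      with I M(1) have "I \<in> A" by (auto simp: A_def)
      with M(2) I(2) show ?thesis by simp
    qed
  qed
  with M(1) show ?thesis by (auto simp: A_def)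
qed

section \<open>Integrality of polynomial values at roots of unity\<close>

text \<open>The characteristic polynomial of an integer matrix is monic with integer coefficients,
  and the eigenvalue is a root of it.\<close>

lemma algebraic_int_if_eigenvalue:
  fixes A :: "int mat" and a :: "'a :: field_char_0"
  assumes "A \<in> carrier_mat n n" "eigenvalue (map_mat of_int A) a"
  shows "algebraic_int a"
proof -
  have "poly (map_poly of_int (char_poly A)) a = 0"
    using assms eigenvalue_root_char_poly[of "map_mat of_int A" n a]
    by (simp add: of_int_hom.char_poly_hom)
  moreover have "lead_coeff (char_poly A) = 1"
    using degree_monic_char_poly[OF assms(1)] by auto
  ultimately show ?thesis unfolding algebraic_int_altdef_ipoly by blast
qed

(* (1, z, ..., z^(n-1)) is an eigenvector, with eigenvalue g(z), of an integer matrix. *)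
lemma algebraic_int_poly_root_of_unity:
  fixes z :: "'a :: field_char_0"
  assumes "z ^ n = 1" "n > 0"
  shows "algebraic_int (poly (map_poly of_int g) z)"
proof -
  \<comment> \<open>Row \<open>i\<close> lists the coefficients of \<open>x^i * g\<close> after
    reduction modulo \<open>x^n - 1\<close>, so evaluating it at \<open>z\<close> multiplies
    \<open>z ^ i\<close> by the value of \<open>g\<close>.\<close>
  define a where "a i j = (\<Sum>k | k \<le> degree g \<and> (i + k) mod n = j. coeff g k)" for i j
  define A where "A = mat n n (\<lambda>(i, j). a i j)"
  define v where "v = vec n (\<lambda>j. z ^ j)"
  have zmod: "z ^ (m mod n) = z ^ m" for m
  proof -
    have "z ^ m = z ^ (n * (m div n) + m mod n)" by simp
    also have "\<dots> = z ^ (m mod n)" unfolding power_add power_mult by (simp add: assms)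
    finally show ?thesis by simp
  qed
  have row: "(\<Sum>j<n. of_int (a i j) * z ^ j) = poly (map_poly of_int g) z * z ^ i" for i
  proof -
    have "(\<Sum>j<n. of_int (a i j) * z ^ j) =
        (\<Sum>j<n. \<Sum>k | k \<in> {..degree g} \<and> (i + k) mod n = j. of_int (coeff g k) * z ^ (i + k))"
      by (rule sum.cong) (auto simp: a_def sum_distrib_right zmod intro!: sum.cong)
    also have "\<dots> = (\<Sum>k\<le>degree g. of_int (coeff g k) * z ^ (i + k))"
      by (rule sum.group) (use assms(2) in auto)
    also have "\<dots> = poly (map_poly of_int g) z * z ^ i"
      by (simp add: poly_altdef sum_distrib_left power_add mult_ac)
    finally show ?thesis .
  qed
  have "eigenvector (map_mat of_int A) v (poly (map_poly of_int g) z)"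
    unfolding eigenvector_def
  proof (intro conjI)
    show "v \<in> carrier_vec (dim_row (map_mat of_int A))" by (simp add: v_def A_def)
    have "vec_index v 0 = 1" using assms(2) by (simp add: v_def)
    then show "v \<noteq> 0\<^sub>v (dim_row (map_mat of_int A))" using assms(2) by (auto simp: A_def)
    show "map_mat of_int A *\<^sub>v v = poly (map_poly of_int g) z \<cdot>\<^sub>v v"
    proof (rule eq_vecI)
      fix i assume "i < dim_vec (poly (map_poly of_int g) z \<cdot>\<^sub>v v)"
      then have "i < n" by (simp add: v_def)
      then show "vec_index (map_mat of_int A *\<^sub>v v) i = vec_index (poly (map_poly of_int g) z \<cdot>\<^sub>v v) i"
        using row[of i] by (simp add: A_def v_def scalar_prod_def atLeast0LessThan)
    qed (simp add: A_def v_def)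
  qed
  then show ?thesis
    using algebraic_int_if_eigenvalue[of A n] by (auto simp: eigenvalue_def A_def)
qed

section \<open>The Frobenius map modulo p\<close>

text \<open>All inner binomial coefficients are divisible by \<open>p\<close>. Divisibility by
  \<open>p\<close> replaces characteristic p, so that the result applies to integer
  polynomials.\<close>

lemma prime_dvd_freshmans_dream:
  fixes x y :: "'a :: comm_ring_1"
  assumes "prime p"
  shows "of_nat p dvd (x + y) ^ p - (x ^ p + y ^ p)"
proof -
  have p: "p > 1" using assms prime_gt_1_nat by blast
  have "(x + y) ^ p = (\<Sum>k\<in>{..p}. of_nat (p choose k) * x ^ k * y ^ (p - k))"
    by (rule binomial_ring)
  also have "{..p} = insert 0 (insert p {0<..<p})" using p by auto
  also have "(\<Sum>k\<in>\<dots>. of_nat (p choose k) * x ^ k * y ^ (p - k)) =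
      x ^ p + y ^ p + (\<Sum>k\<in>{0<..<p}. of_nat (p choose k) * x ^ k * y ^ (p - k))"
    using p by (simp add: algebra_simps)
  finally have "(x + y) ^ p - (x ^ p + y ^ p) =
      (\<Sum>k\<in>{0<..<p}. of_nat (p choose k) * x ^ k * y ^ (p - k))" by simp
  moreover have "of_nat p dvd (of_nat (p choose k) :: 'a)" if "k \<in> {0<..<p}" for k
    using dvd_choose_prime[of k p] that assms by (auto elim!: dvdE)
  ultimately show ?thesis by (auto intro!: dvd_sum dvd_mult2)
qed

lemma prime_dvd_freshmans_dream_power:
  fixes x y :: "'a :: comm_ring_1"
  assumes "prime p"
  shows "of_nat p dvd (x + y) ^ (p ^ f) - (x ^ (p ^ f) + y ^ (p ^ f))"
proof (induction f)
  case (Suc f)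
  let ?a = "(x + y) ^ (p ^ f)" and ?x = "x ^ (p ^ f)" and ?y = "y ^ (p ^ f)"
  \<comment> \<open>A difference divides the difference of the p-th powers, so the congruence from
    the induction hypothesis may be raised to the power \<open>p\<close>.\<close>
  have "?a - (?x + ?y) dvd ?a ^ p - (?x + ?y) ^ p"
    unfolding power_diff_sumr2 by simp
  with Suc have "of_nat p dvd ?a ^ p - (?x + ?y) ^ p" by (rule dvd_trans)
  moreover have "of_nat p dvd (?x + ?y) ^ p - (?x ^ p + ?y ^ p)"
    using assms by (rule prime_dvd_freshmans_dream)
  ultimately have "of_nat p dvd (?a ^ p - (?x + ?y) ^ p) + ((?x + ?y) ^ p - (?x ^ p + ?y ^ p))"
    by (rule dvd_add)
  then show ?case by (simp add: power_mult[symmetric] algebra_simps)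
qed simp

text \<open>Fermat's little theorem, iterated. The freshman's dream with \<open>y = 1\<close> leads
  from an integer to its successor and also back to its predecessor.\<close>

lemma prime_dvd_minus_power_of_int:
  assumes "prime p"
  shows "of_nat p dvd (of_int a :: 'a :: comm_ring_1) ^ (p ^ f) - of_int a"
proof (induction a rule: int_induct[where k = 0])
  case base
  show ?case using assms by (simp add: power_0_left prime_gt_0_nat)
next
  case (step1 i)
  have "of_nat p dvd ((of_int i + 1) ^ (p ^ f) - (of_int i ^ (p ^ f) + 1 ^ (p ^ f)) +
      (of_int i ^ (p ^ f) - of_int i) :: 'a)"
    using prime_dvd_freshmans_dream_power[OF assms] step1(2) by (rule dvd_add)
  then show ?case by (simp add: algebra_simps)
next
  case (step2 i)
  have "of_nat p dvd ((of_int i ^ (p ^ f) - of_int i) -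
      ((of_int (i - 1) + 1) ^ (p ^ f) - (of_int (i - 1) ^ (p ^ f) + 1 ^ (p ^ f))) :: 'a)"
    using step2(2) prime_dvd_freshmans_dream_power[OF assms] by (rule dvd_diff)
  then show ?case by (simp add: algebra_simps)
qed

text \<open>Induction on the coefficients, writing \<open>pCons a g\<close> as a constant plus the
  variable times \<open>g\<close>: the freshman's dream splits the power, Fermat handles the
  constant, and the induction hypothesis handles \<open>g\<close>.\<close>

lemma prime_dvd_poly_frobenius:
  fixes g :: "int poly"
  assumes "prime p"
  shows "of_nat p dvd g ^ (p ^ f) - pcompose g (monom 1 (p ^ f))"
proof (induction g)
  case 0
  show ?case using assms by (simp add: power_0_left prime_gt_0_nat)
next
  case (pCons a g)
  let ?q = "p ^ f"
  have eq: "pCons a g = of_int a + monom 1 1 * g"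
    by (simp add: of_int_poly monom_altdef)
  have "of_nat p dvd (pCons a g ^ ?q - (of_int a ^ ?q + (monom 1 1 * g) ^ ?q))
      + (of_int a ^ ?q - of_int a) + monom 1 ?q * (g ^ ?q - pcompose g (monom 1 ?q))"
    unfolding eq
    by (intro dvd_add dvd_mult prime_dvd_freshmans_dream_power prime_dvd_minus_power_of_int
        assms pCons.IH)
  also have "\<dots> = pCons a g ^ ?q - pcompose (pCons a g) (monom 1 ?q)"
    by (simp add: pcompose_pCons power_mult_distrib monom_power of_int_poly algebra_simps)
  finally show ?case .
qed

section \<open>Primitive roots of unity\<close>

text \<open>As polynomials in \<open>x\<close>, both sides are monic of degree \<open>n\<close> and
  vanish at the \<open>n\<close> powers of \<open>z\<close>, which are distinct because
  \<open>z\<close> has exact order \<open>n\<close>.\<close>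

lemma prod_roots_of_unity:
  fixes z x :: "'a :: idom"
  assumes "n > 0" "z ^ n = 1" "\<And>k. 0 < k \<Longrightarrow> k < n \<Longrightarrow> z ^ k \<noteq> 1"
  shows "(\<Prod>i<n. x - z ^ i) = x ^ n - 1"
proof -
  have "z \<noteq> 0" using assms(1,2) by (auto simp: power_0_left)
  have inj: "inj_on (\<lambda>i. z ^ i) {..<n}"
  proof (rule linorder_inj_onI)
    fix i j assume "i < j" "j \<in> {..<n}"
    show "z ^ i \<noteq> z ^ j"
    proof
      assume "z ^ i = z ^ j"
      moreover have "z ^ j = z ^ i * z ^ (j - i)"
        using \<open>i < j\<close> by (simp flip: power_add)
      ultimately have "z ^ i * z ^ (j - i) = z ^ i * 1" by simp
      then have "z ^ (j - i) = 1" using \<open>z \<noteq> 0\<close> by simp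
      then show False using assms(3)[of "j - i"] \<open>i < j\<close> \<open>j \<in> {..<n}\<close>
        by (simp add: less_imp_diff_less)
    qed
  qed auto
  let ?P = "\<Prod>i<n. [:- (z ^ i), 1:]" and ?Q = "monom 1 n - 1 :: 'a poly"
  have deg: "degree ?P = n" by (simp add: degree_prod_eq_sum_degree)
  have "lead_coeff ?P = 1" unfolding lead_coeff_prod by simp
  then have lead: "coeff ?P n = 1" unfolding deg .
  have degQ: "degree ?Q \<le> n" by (intro degree_diff_le) (auto simp: degree_monom_le)
  have "?P = ?Q"
  proof (rule poly_eqI_degree_lead_coeff)
    show "n \<le> card ((\<lambda>i. z ^ i) ` {..<n})" using inj by (simp add: card_image)
    show "coeff ?P n = coeff ?Q n" using lead assms(1) by simp
    fix w assume "w \<in> (\<lambda>i. z ^ i) ` {..<n}"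
    then obtain i where i: "i < n" "w = z ^ i" by auto
    then have "w ^ n = 1" using assms(2) by (metis mult.commute power_mult power_one)
    then show "poly ?P w = poly ?Q w" using i
      by (auto simp: poly_prod poly_monom intro: prod_zero)
  qed (use deg degQ in auto)
  then have "poly ?P x = poly ?Q x" by simp
  then show ?thesis by (simp add: poly_prod poly_monom)
qed

lemma ex_primitive_root_of_unity_complex:
  assumes "n > 0"
  shows "\<exists>z :: complex. z ^ n = 1 \<and> (\<forall>k. 0 < k \<longrightarrow> k < n \<longrightarrow> z ^ k \<noteq> 1)"
proof -
  define z where "z = cis (2 * pi / real n)"
  have pow: "z ^ k = cis (2 * pi * real k / real n)" for k
    by (simp add: z_def Complex.DeMoivre mult_ac)
  have inj: "inj_on (\<lambda>k. z ^ k) {..<n}"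
    using bij_betw_roots_unity[OF assms] by (simp add: pow bij_betw_def)
  have "z ^ k \<noteq> 1" if "0 < k" "k < n" for k
    using inj_onD[OF inj, of k 0] that by auto
  moreover have "z ^ n = 1" using assms by (simp add: pow)
  ultimately show ?thesis by blast
qed


section \<open>A field with q elements\<close>

text \<open>The field is realised as a quotient of the integer polynomials, with \<open>ev\<close>
  as the map onto Z[z]. An identity in Z[z] becomes membership in the maximal ideal
  \<open>M\<close>, since \<open>M\<close> contains every polynomial with value 0 at
  \<open>z\<close>.\<close>

lemma ex_finite_field:
  fixes p f :: nat
  assumes "prime p" "f > 0"
  shows "\<exists>F :: int poly set ring. field F \<and> card (carrier F) = p ^ f"
proof -
  define q where "q = p ^ f"
  define n where "n = q - 1"
  have p: "p > 1" using assms(1) prime_gt_1_nat by blast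
  then have q: "q > 1" unfolding q_def using assms(2) by (rule one_less_power)
  then have n: "n > 0" "q = Suc n" by (auto simp: n_def)
  obtain z :: complex where z: "z ^ n = 1" "\<And>k. 0 < k \<Longrightarrow> k < n \<Longrightarrow> z ^ k \<noteq> 1"
    using ex_primitive_root_of_unity_complex[OF n(1)] by blast
  define ev where "ev g = poly (map_poly of_int g) z" for g :: "int poly"
  have ev_simps [simp]: "ev 0 = 0" "ev 1 = 1" "ev (a + b) = ev a + ev b" "ev (a - b) = ev a - ev b"
    "ev (- a) = - ev a" "ev (a * b) = ev a * ev b" "ev (a ^ m) = ev a ^ m"
    "ev (of_nat m) = of_nat m" "ev (monom 1 m) = z ^ m" for a b m
    by (simp_all add: ev_def hom_distribs poly_monom of_nat_poly)
  have ev_prod [simp]: "ev (prod h A) = (\<Prod>i\<in>A. ev (h i))" for h and A :: "nat set"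
    by (induction A rule: infinite_finite_induct) auto
  have ev_sum [simp]: "ev (sum h A) = (\<Sum>i\<in>A. ev (h i))" for h and A :: "nat set"
    by (induction A rule: infinite_finite_induct) auto

  define R :: "int poly ring" where
    "R = \<lparr>carrier = UNIV, monoid.mult = (*), one = 1, ring.zero = 0, add = (+)\<rparr>"
  interpret R: cring R
    unfolding R_def
    by unfold_locales (auto simp: algebra_simps Units_def intro: exI[of _ "- x" for x])
  have R_simps: "carrier R = UNIV" "\<one>\<^bsub>R\<^esub> = 1" "\<zero>\<^bsub>R\<^esub> = 0" "a \<otimes>\<^bsub>R\<^esub> b = a * b" "a \<oplus>\<^bsub>R\<^esub> b = a + b" for a b
    by (simp_all add: R_def)
  have R_uminus: "\<ominus>\<^bsub>R\<^esub> a = - a" for a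
    by (rule sym, rule R.sum_zero_eq_neg) (simp_all add: R_simps)
  have R_minus: "a \<ominus>\<^bsub>R\<^esub> b = a - b" for a b
    by (simp add: a_minus_def R_uminus R_simps)

  (* The preimage of p Z[z] under evaluation at z. *)
  define J where "J = {g. \<exists>h. ev g = of_nat p * ev h}"
  have J0: "g \<in> J" if "ev g = 0" for g
    using that by (auto simp: J_def intro!: exI[of _ 0])
  have Jp: "g \<in> J" if "of_nat p dvd g" for g
    using that by (auto simp: J_def elim!: dvdE)
  have "ideal J R"
  proof (rule idealI)
    show "subgroup J (add_monoid R)"
    proof
      fix x y assume "x \<in> J" "y \<in> J"
      then obtain a b where "ev x = of_nat p * ev a" "ev y = of_nat p * ev b" by (auto simp: J_def)
      then have "ev (x + y) = of_nat p * ev (a + b)" by (simp add: algebra_simps)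
      then have "x + y \<in> J" unfolding J_def by blast
      then show "x \<otimes>\<^bsub>add_monoid R\<^esub> y \<in> J" by (simp add: R_simps)
    next
      fix x assume "x \<in> J"
      then obtain a where "ev x = of_nat p * ev a" by (auto simp: J_def)
      then have "ev (- x) = of_nat p * ev (- a)" by simp
      then have "- x \<in> J" unfolding J_def by blast
      then show "inv\<^bsub>add_monoid R\<^esub> x \<in> J" using R_uminus[of x] by (simp add: a_inv_def)
    qed (auto simp: R_simps J0)
    fix a x assume "a \<in> J"
    then obtain b where "ev a = of_nat p * ev b" by (auto simp: J_def)
    then have "ev (x * a) = of_nat p * ev (x * b)" by simp
    then have "x * a \<in> J" unfolding J_def by blast
    then show "x \<otimes>\<^bsub>R\<^esub> a \<in> J" "a \<otimes>\<^bsub>R\<^esub> x \<in> J" by (simp_all add: R_simps mult.commute)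
  qed (rule R.ring_axioms)
  \<comment> \<open>Otherwise 1/p would be the value of an integer polynomial at \<open>z\<close>,
    hence a rational algebraic integer, hence an integer.\<close>
  moreover have "\<one>\<^bsub>R\<^esub> \<notin> J"
  proof
    assume "\<one>\<^bsub>R\<^esub> \<in> J"
    then obtain h where "1 = of_nat p * ev h" by (auto simp: J_def R_simps)
    then have h: "ev h = 1 / of_nat p" using p by (simp add: field_simps)
    have "algebraic_int (ev h)"
      unfolding ev_def using algebraic_int_poly_root_of_unity[OF z(1) n(1)] .
    then have "1 / of_nat p \<in> (\<int> :: complex set)"
      unfolding h by (rule rational_algebraic_int_is_int) simp
    then obtain k where "1 / of_nat p = (of_int k :: complex)" by (elim Ints_cases)
    then have "of_int (k * int p) = (of_int 1 :: complex)" using p by (simp add: field_simps)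
    then have "k * int p = 1" by (simp only: of_int_eq_iff)
    then show False using p by (simp add: zmult_eq_1_iff)
  qed
  ultimately obtain M where M: "maximalideal M R" "J \<subseteq> M"
    using R.ex_maximalideal_superset by blast
  interpret M: maximalideal M R by (rule M(1))
  interpret M: primeideal M R by (rule R.maximalideal_prime[OF M(1)])
  have M_add: "a + b \<in> M" if "a \<in> M" "b \<in> M" for a b
    using M.a_closed[OF that] by (simp add: R_simps)
  have M_diff: "a - b \<in> M" if "a \<in> M" "b \<in> M" for a b
    using M_add[OF that(1) M.a_inv_closed[OF that(2)]] by (simp add: R_uminus)
  have M_mult: "x * a \<in> M" if "a \<in> M" for a x
    using M.I_l_closed[OF that, of x] by (simp add: R_simps)
  have M_0: "0 \<in> M" using M.zero_closed by (simp add: R_simps)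
  have M_sum: "sum h A \<in> M" if "\<And>i. i \<in> A \<Longrightarrow> h i \<in> M" for h and A :: "nat set"
    using that by (induction A rule: infinite_finite_induct) (auto intro: M_0 M_add)
  have M_prime: "a \<in> M \<or> b \<in> M" if "a * b \<in> M" for a b
    using M.I_prime[of a b] that by (simp add: R_simps)
  have M_1: "1 \<notin> M"
    using M.one_imp_carrier M.I_notcarr by (auto simp: R_simps)
  \<comment> \<open>As \<open>f > 0\<close>, \<open>p\<close> divides \<open>q\<close>, so
    \<open>q\<close> lies in \<open>M\<close> and \<open>n = q - 1\<close> is congruent to
    -1.\<close>
  have M_n: "of_nat n \<notin> M"
  proof
    assume "of_nat n \<in> M"
    moreover have "of_nat q \<in> M"
      using M(2) Jp[of "of_nat q"] assms(2) by (auto simp: q_def)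
    ultimately have "of_nat q - of_nat n \<in> M" by (intro M_diff)
    then show False using M_1 by (simp add: n(2))
  qed

  \<comment> \<open>If \<open>?w\<close> were congruent to 1, the sum of its first \<open>n\<close>
    powers would be congruent to \<open>n\<close>. At \<open>z\<close> this sum is 0, because
    \<open>z ^ k\<close> is an n-th root of unity other than 1. So \<open>n\<close> would lie in
    \<open>M\<close>.\<close>
  have monom_diff: "monom 1 k - 1 \<notin> M" if k: "0 < k" "k < n" for k
  proof
    assume *: "monom 1 k - 1 \<in> M"
    let ?w = "monom 1 k :: int poly"
    have "(z ^ k - 1) * (\<Sum>j<n. (z ^ k) ^ j) = (z ^ k) ^ n - 1"
      by (rule power_diff_1_eq[symmetric])
    also have "\<dots> = 0" using z(1) by (simp flip: power_mult add: mult.commute[of k]) (simp add: power_mult)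
    finally have "ev (\<Sum>j<n. ?w ^ j) = 0" using z(2)[OF k] by simp
    with J0 M(2) have "(\<Sum>j<n. ?w ^ j) \<in> M" by blast
    moreover have "(\<Sum>j<n. ?w ^ j - 1) \<in> M"
    proof (rule M_sum)
      fix j
      show "?w ^ j - 1 \<in> M"
        unfolding power_diff_1_eq[of ?w j]
        using M_mult[OF *, of "\<Sum>i<j. ?w ^ i"] by (simp only: mult.commute)
    qed
    ultimately have "(\<Sum>j<n. ?w ^ j) - (\<Sum>j<n. ?w ^ j - 1) \<in> M" by (rule M_diff)
    then show False using M_n by (simp add: sum_subtractf)
  qed

  \<comment> \<open>Representatives of the residue classes: 0 and the \<open>n = q - 1\<close>
    powers of the variable.\<close>
  define K where "K = insert 0 ((\<lambda>i. monom 1 i) ` {..<n} :: int poly set)"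
  \<comment> \<open>The powers of the variable are units modulo \<open>M\<close>: the product with
    the complementary power has value \<open>z ^ (n * i) = 1\<close> at \<open>z\<close>.\<close>
  have monom_notin: "monom 1 i \<notin> M" for i
  proof
    assume "monom 1 i \<in> M"
    then have "monom 1 (i * (n - 1)) * monom 1 i \<in> M" by (rule M_mult)
    moreover have "i * (n - 1) + i = n * i" using n(1) by (cases n) auto
    then have "ev (monom 1 (i * (n - 1)) * monom 1 i - 1) = 0"
      by (simp flip: power_add) (simp add: power_mult z(1))
    with J0 M(2) have "monom 1 (i * (n - 1)) * monom 1 i - 1 \<in> M" by blast
    ultimately have "monom 1 (i * (n - 1)) * monom 1 i - (monom 1 (i * (n - 1)) * monom 1 i - 1) \<in> M"
      by (rule M_diff)
    then show False using M_1 by simp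
  qed
  have monom_inj: "monom 1 j - monom 1 i \<notin> M" if "i < j" "j < n" for i j
  proof
    assume "monom 1 j - monom 1 i \<in> M"
    also have "monom 1 j - monom 1 i = monom 1 i * (monom 1 (j - i) - 1 :: int poly)"
      using that by (simp add: algebra_simps mult_monom)
    finally show False using M_prime monom_notin monom_diff[of "j - i"] that by force
  qed
  have K_inj: "a = b" if "a \<in> K" "b \<in> K" "a - b \<in> M" for a b
  proof -
    have "b - a \<in> M" using M_diff[OF M_0 that(3)] by simp
    then show ?thesis using that monom_notin monom_inj M_diff[OF M_0]
      unfolding K_def by (auto, metis linorder_neqE_nat)
  qed
  \<comment> \<open>The product of \<open>g\<close> and all \<open>g - monom 1 i\<close> has value
    \<open>ev g ^ q - ev g\<close> at \<open>z\<close>. Since \<open>z ^ q = z\<close>, this is also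
    the value of \<open>g ^ q - pcompose g (monom 1 q)\<close>, a multiple of \<open>p\<close>.
    Hence the product lies in \<open>M\<close>, and primality singles out a factor.\<close>
  have K_surj: "\<exists>a\<in>K. g - a \<in> M" for g
  proof -
    have "ev (pcompose g (monom 1 q)) = ev g"
      using z(1) by (simp add: ev_def of_int_hom.map_poly_pcompose poly_pcompose poly_monom n(2))
    then have "ev (g * (\<Prod>i<n. g - monom 1 i) - (g ^ q - pcompose g (monom 1 q))) = 0"
      using prod_roots_of_unity[OF n(1) z, of "ev g"] by (simp add: n(2) right_diff_distrib)
    with J0 M(2) have "g * (\<Prod>i<n. g - monom 1 i) - (g ^ q - pcompose g (monom 1 q)) \<in> M" by blast
    moreover have "g ^ q - pcompose g (monom 1 q) \<in> M"
      using prime_dvd_poly_frobenius[OF assms(1)] Jp M(2) unfolding q_def by blast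
    ultimately have "g * (\<Prod>i<n. g - monom 1 i) \<in> M"
      using M_add by fastforce
    moreover have "\<exists>i\<in>A. g - monom 1 i \<in> M" if "(\<Prod>i\<in>A. g - monom 1 i) \<in> M" for A :: "nat set"
      using that by (induction A rule: infinite_finite_induct) (auto simp: M_1 dest!: M_prime)
    ultimately show ?thesis using M_prime unfolding K_def by fastforce
  qed
  have "inj_on (\<lambda>i. monom 1 i :: int poly) {..<n}"
    by (auto simp: inj_on_def monom_eq_iff')
  then have card_K: "card K = q"
    unfolding K_def n(2) by (subst card_insert_disjoint) (auto simp: card_image)
  have "bij_betw (\<lambda>a. M +>\<^bsub>R\<^esub> a) K (carrier (R Quot M))"
    unfolding bij_betw_def
  proof
    have eq_iff: "M +>\<^bsub>R\<^esub> a = M +>\<^bsub>R\<^esub> b \<longleftrightarrow> a - b \<in> M" for a b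
      using R.quotient_eq_iff_same_a_r_cos[of M a b] M.ideal_axioms by (simp add: R_minus R_simps)
    show "inj_on (\<lambda>a. M +>\<^bsub>R\<^esub> a) K"
      using K_inj by (simp add: inj_on_def eq_iff)
    show "(\<lambda>a. M +>\<^bsub>R\<^esub> a) ` K = carrier (R Quot M)"
    proof
      show "(\<lambda>a. M +>\<^bsub>R\<^esub> a) ` K \<subseteq> carrier (R Quot M)"
        by (auto simp: FactRing_def A_RCOSETS_def' R_simps)
      show "carrier (R Quot M) \<subseteq> (\<lambda>a. M +>\<^bsub>R\<^esub> a) ` K"
      proof
        fix N assume "N \<in> carrier (R Quot M)"
        then obtain g where g: "N = M +>\<^bsub>R\<^esub> g" by (auto simp: FactRing_def A_RCOSETS_def')
        obtain a where "a \<in> K" "g - a \<in> M" using K_surj by blast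
        with g eq_iff show "N \<in> (\<lambda>a. M +>\<^bsub>R\<^esub> a) ` K" by blast
      qed
    qed
  qed
  then have "card (carrier (R Quot M)) = q" using card_K bij_betw_same_card by fastforce
  moreover have "field (R Quot M)" by (rule M.quotient_is_field[OF R.is_cring])
  ultimately show ?thesis unfolding q_def by blast
qed

section \<open>Halving modulo an odd number, and reflections in an affine plane\<close>

lemma cong_double_odd_iff:
  fixes a b q :: nat
  assumes "odd q" "a < q" "b < q"
  shows "[2 * a = 2 * b] (mod q) \<longleftrightarrow> a = b"
proof -
  have "[2 * a = 2 * b] (mod q) \<longleftrightarrow> [a = b] (mod q)"
    using assms(1) by (intro cong_mult_lcancel_nat) simp
  also have "\<dots> \<longleftrightarrow> a = b"
    using assms(2,3) by (simp add: cong_def)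
  finally show ?thesis .
qed

text \<open>For odd \<open>q\<close>, \<open>(q + 1) div 2\<close> is the inverse of 2 modulo
  \<open>q\<close>. This supplies the midpoint of two points.\<close>

lemma ex_half_mod_odd:
  fixes q s :: nat
  assumes "odd q"
  shows "\<exists>c<q. [s = 2 * c] (mod q)"
proof (intro exI conjI)
  let ?c = "(s * ((q + 1) div 2)) mod q"
  show "?c < q" using assms by (simp add: odd_pos)
  have "[2 * ?c = 2 * (s * ((q + 1) div 2))] (mod q)"
    by (intro cong_mult cong_refl) (simp add: cong_def)
  also have "2 * (s * ((q + 1) div 2)) = s + s * q"
    using assms by (auto elim!: oddE)
  also have "[s + s * q = s] (mod q)" by (simp add: cong_def)
  finally show "[s = 2 * ?c] (mod q)" by (rule cong_sym)
qed

(* lam d u is the index of the line through u in direction d. *)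
locale affine_plane_coords =
  fixes X :: "'a set" and D :: "'d set" and q :: nat and lam :: "'d \<Rightarrow> 'a \<Rightarrow> nat"
  assumes finite_X: "finite X" and card_X: "card X = q ^ 2"
    and finite_D: "finite D" and card_D: "card D = q + 1"
    and lam_less: "d \<in> D \<Longrightarrow> u \<in> X \<Longrightarrow> lam d u < q"
    and ex1_join: "u \<in> X \<Longrightarrow> v \<in> X \<Longrightarrow> u \<noteq> v \<Longrightarrow> \<exists>!d. d \<in> D \<and> lam d u = lam d v"
begin

lemma join_unique:
  assumes "u \<in> X" "v \<in> X" "u \<noteq> v" "d \<in> D" "e \<in> D" "lam d u = lam d v" "lam e u = lam e v"
  shows "d = e"
  using ex1_join[OF assms(1-3)] assms(4-) by blast

text \<open>Two points that agree in both coordinates would be joined by two directions, so the map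
  is injective; it is onto because both sides have \<open>q ^ 2\<close> elements.\<close>

lemma bij_betw_coords:
  assumes "d \<in> D" "e \<in> D" "d \<noteq> e"
  shows "bij_betw (\<lambda>u. (lam d u, lam e u)) X ({..<q} \<times> {..<q})"
proof -
  have inj: "inj_on (\<lambda>u. (lam d u, lam e u)) X"
    using join_unique assms by (auto simp: inj_on_def)
  have "(\<lambda>u. (lam d u, lam e u)) ` X = {..<q} \<times> {..<q}"
  proof (rule card_subset_eq)
    show "card ((\<lambda>u. (lam d u, lam e u)) ` X) = card ({..<q} \<times> {..<q})"
      using inj by (simp add: card_image card_X power2_eq_square)
  qed (use assms lam_less in auto)
  with inj show ?thesis by (simp add: bij_betw_def)
qed

lemma ex1_point:
  assumes "d \<in> D" "e \<in> D" "d \<noteq> e" "a < q" "b < q"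
  shows "\<exists>!u. u \<in> X \<and> lam d u = a \<and> lam e u = b"
proof -
  have "(a, b) \<in> (\<lambda>u. (lam d u, lam e u)) ` X"
    using bij_betw_coords[OF assms(1-3)] assms(4,5) by (simp add: bij_betw_def)
  then obtain u where "u \<in> X" "lam d u = a" "lam e u = b" by auto
  then show ?thesis using join_unique[OF _ _ _ assms(1,2)] assms(3) by (intro ex1I[of _ u]) auto
qed

definition line :: "'d \<Rightarrow> nat \<Rightarrow> 'a set" where
  "line d c = {u \<in> X. lam d u = c}"

(* v is the image of u under the reflection with axis line d c along direction e. *)
definition mirror :: "'d \<Rightarrow> 'd \<Rightarrow> nat \<Rightarrow> 'a \<Rightarrow> 'a \<Rightarrow> bool" where
  "mirror d e c u v \<longleftrightarrow>
     u \<in> X \<and> v \<in> X \<and> u \<noteq> v \<and> lam e u = lam e v \<and> [lam d u + lam d v = 2 * c] (mod q)"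

definition mirror_pairs :: "'d \<Rightarrow> 'd \<Rightarrow> nat \<Rightarrow> 'a set set" where
  "mirror_pairs d e c = {{u, v} | u v. mirror d e c u v}"

lemma mirror_sym: "mirror d e c u v \<Longrightarrow> mirror d e c v u"
  by (auto simp: mirror_def add.commute)

text \<open>The coordinate of any other direction numbers the points of the line.\<close>

lemma card_line:
  assumes "d \<in> D" "e \<in> D" "d \<noteq> e" "c < q"
  shows "card (line d c) = q"
proof -
  have "bij_betw (lam e) (line d c) {..<q}"
    unfolding bij_betw_def
  proof
    show "inj_on (lam e) (line d c)"
    proof (rule inj_onI)
      fix u v assume "u \<in> line d c" "v \<in> line d c" "lam e u = lam e v"
      then show "u = v" using join_unique[of u v d e] assms by (auto simp: line_def)
    qed
    show "lam e ` line d c = {..<q}"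
      using ex1_point[OF assms] lam_less[OF assms(2)] by (fastforce simp: line_def)
  qed
  then show ?thesis by (metis bij_betw_same_card card_lessThan)
qed

context
  fixes d e :: 'd and c :: nat
  assumes de: "d \<in> D" "e \<in> D" "d \<noteq> e" and c: "c < q" and odd_q: "odd q"
begin

text \<open>The image of a point on the axis would again have coordinate \<open>c\<close>, as well
  as the same \<open>e\<close>-coordinate, and so be the point itself; \<open>mirror\<close>
  excludes this.\<close>

lemma mirror_notin_line:
  assumes "mirror d e c u v"
  shows "u \<notin> line d c" "v \<notin> line d c"
proof -
  have "u \<notin> line d c" if "mirror d e c u v" for u v
  proof
    assume "u \<in> line d c"
    with that have "[c + lam d v = c + c] (mod q)" by (simp add: mirror_def line_def mult_2)
    then have "[lam d v = c] (mod q)" by (simp only: cong_add_lcancel_nat)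
    then have "lam d v = c"
      using that lam_less[OF de(1)] c cong_less_modulus_unique_nat by (auto simp: mirror_def)
    with that \<open>u \<in> line d c\<close> show False
      using join_unique[of u v d e] de by (auto simp: mirror_def line_def)
  qed
  with assms mirror_sym show "u \<notin> line d c" "v \<notin> line d c" by blast+
qed

text \<open>Both coordinates of the image are prescribed, which determines it. It differs from
  \<open>u\<close>, since otherwise halving would put \<open>u\<close> on the axis.\<close>

lemma ex1_mirror:
  assumes "u \<in> X" "u \<notin> line d c"
  shows "\<exists>!v. mirror d e c u v"
proof -
  have q: "q > 0" using c by simp
  \<comment> \<open>The residue of \<open>2 * c - lam d u\<close>, with \<open>q - lam d u\<close>
    as the negative to stay within the natural numbers.\<close>
  define a where "a = (2 * c + (q - lam d u)) mod q"
  have a: "a < q" using q by (simp add: a_def)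
  have lt: "lam d u < q" using lam_less de(1) assms(1) by blast
  have "[lam d u + a = lam d u + (2 * c + (q - lam d u))] (mod q)"
    unfolding a_def by (intro cong_add cong_refl) (simp add: cong_def)
  also have "lam d u + (2 * c + (q - lam d u)) = 2 * c + q" using lt by simp
  also have "[2 * c + q = 2 * c] (mod q)" by (simp add: cong_def)
  finally have sum_a: "[lam d u + a = 2 * c] (mod q)" .
  have iff: "[lam d u + x = 2 * c] (mod q) \<longleftrightarrow> x = a" if "x < q" for x
  proof
    assume "[lam d u + x = 2 * c] (mod q)"
    then have "[lam d u + x = lam d u + a] (mod q)" using sum_a by (metis cong_sym cong_trans)
    then show "x = a" using that a cong_less_modulus_unique_nat by (simp add: cong_add_lcancel_nat)
  qed (use sum_a in simp)
  obtain v where v: "v \<in> X" "lam d v = a" "lam e v = lam e u"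
    using ex1_point[OF de a, of "lam e u"] lam_less de(2) assms(1) by blast
  have "u \<noteq> v"
  proof
    assume "u = v"
    then have "[2 * lam d u = 2 * c] (mod q)" using sum_a v(2) by (simp add: mult_2)
    then have "lam d u = c" using cong_double_odd_iff[OF odd_q lt c] by blast
    with assms show False by (simp add: line_def)
  qed
  then have "mirror d e c u v" using v assms(1) sum_a by (simp add: mirror_def)
  moreover have "w = v" if "mirror d e c u w" for w
  proof -
    have "w \<in> X" "lam d w = a" "lam e w = lam e u"
      using that iff lam_less[OF de(1)] by (auto simp: mirror_def)
    then show ?thesis using ex1_point[OF de a, of "lam e u"] v lam_less[OF de(2) assms(1)] by blast
  qed
  ultimately show ?thesis by blast
qed

text \<open>Off the axis the reflection is an involution without fixed points, so its orbits are
  pairs that cover each such point once.\<close>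

lemma parallel_class_mirror:
  "parallel_class X (insert (line d c) (mirror_pairs d e c))"
  unfolding parallel_class_def
proof (intro conjI ballI)
  show "insert (line d c) (mirror_pairs d e c) \<subseteq> Pow X"
    by (auto simp: line_def mirror_pairs_def mirror_def)
  fix u assume u: "u \<in> X"
  show "\<exists>!b. b \<in> insert (line d c) (mirror_pairs d e c) \<and> u \<in> b"
  proof (cases "u \<in> line d c")
    case True
    then have "b = line d c" if "b \<in> insert (line d c) (mirror_pairs d e c)" "u \<in> b" for b
      using that True mirror_notin_line by (auto simp: mirror_pairs_def)
    with True show ?thesis by blast
  next
    case False
    obtain v where v: "mirror d e c u v" "\<And>w. mirror d e c u w \<Longrightarrow> w = v"
      using ex1_mirror[OF u False] by blast
    have "b = {u, v}" if "b \<in> insert (line d c) (mirror_pairs d e c)" "u \<in> b" for b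
      using that False v(2) mirror_sym by (fastforce simp: mirror_pairs_def)
    moreover have "{u, v} \<in> mirror_pairs d e c" using v(1) by (auto simp: mirror_pairs_def)
    ultimately show ?thesis by blast
  qed
qed

lemma block_sizes_mirror:
  "block_sizes (insert (line d c) (mirror_pairs d e c)) =
     add_mset q (replicate_mset ((q ^ 2 - q) div 2) 2)"
proof -
  let ?S = "mirror_pairs d e c"
  have fin: "finite ?S"
    by (rule finite_subset[OF _ finite_Pow_iff[THEN iffD2, OF finite_X]])
       (auto simp: mirror_pairs_def mirror_def)
  have card2: "card b = 2" if "b \<in> ?S" for b
    using that by (auto simp: mirror_pairs_def mirror_def)
  have line: "line d c \<subseteq> X" "line d c \<noteq> {}"
  proof -
    show "line d c \<subseteq> X" by (auto simp: line_def)
    show "line d c \<noteq> {}" using card_line[OF de c] c by (metis card.empty less_nat_zero_code)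
  qed
  have disj_line: "b \<inter> line d c = {}" if "b \<in> ?S" for b
    using that mirror_notin_line by (auto simp: mirror_pairs_def)
  have Union: "\<Union>?S = X - line d c"
  proof
    show "\<Union>?S \<subseteq> X - line d c"
      using disj_line by (auto simp: mirror_pairs_def mirror_def)
    show "X - line d c \<subseteq> \<Union>?S"
    proof
      fix u assume "u \<in> X - line d c"
      then obtain v where "mirror d e c u v" using ex1_mirror by blast
      then show "u \<in> \<Union>?S" by (auto simp: mirror_pairs_def)
    qed
  qed
  have disj: "b \<inter> b' = {}" if "b \<in> ?S" "b' \<in> ?S" "b \<noteq> b'" for b b'
  proof (rule ccontr)
    assume "b \<inter> b' \<noteq> {}"
    then obtain u where u: "u \<in> b" "u \<in> b'" by blast
    then have "u \<in> X" using that(1) by (auto simp: mirror_pairs_def mirror_def)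
    then show False using parallel_class_mirror that u unfolding parallel_class_def by blast
  qed
  \<comment> \<open>The disjoint pairs fill the \<open>q ^ 2 - q\<close> points off the
    axis.\<close>
  have "2 * card ?S = card (\<Union>?S)"
    by (rule card_partition) (use fin finite_X card2 disj Union in auto)
  also have "\<dots> = q ^ 2 - q"
    unfolding Union using line(1) finite_X card_line[OF de c]
    by (simp add: card_Diff_subset finite_subset card_X)
  finally have "card ?S = (q ^ 2 - q) div 2" by simp
  moreover have "image_mset card (mset_set ?S) = replicate_mset (card ?S) 2"
  proof -
    have "image_mset card (mset_set ?S) = image_mset (\<lambda>_. 2) (mset_set ?S)"
      by (rule image_mset_cong) (use fin card2 in simp)
    then show ?thesis by (simp add: image_mset_const_eq)
  qed
  \<comment> \<open>The axis is nonempty and meets no pair, so inserting it adds its size to the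
    multiset.\<close>
  moreover have "line d c \<notin> ?S" using disj_line line(2) by blast
  ultimately show ?thesis
    using fin card_line[OF de c] by (simp add: block_sizes_def)
qed

end

section \<open>The design from two matched halves of the directions\<close>

lemma ex_curd:
  assumes q: "odd q" "q > 1"
  shows "\<exists>B C. curd 1 X B C \<and>
    has_class_partition C (add_mset q (replicate_mset ((q ^ 2 - q) div 2) 2))"
proof -
  have "(q + 1) div 2 \<le> card D" by (simp add: card_D)
  then obtain D1 where D1: "D1 \<subseteq> D" "card D1 = (q + 1) div 2"
    using obtain_subset_with_card_n by metis
  define D2 where "D2 = D - D1"
  have fin: "finite D1" "finite D2" using D1 finite_D finite_subset by (auto simp: D2_def)
  \<comment> \<open>As \<open>q\<close> is odd, \<open>q + 1\<close> is even and the two halves can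
    be matched.\<close>
  have "card D2 = (q + 1) div 2"
    using D1 fin q(1) card_D by (simp add: D2_def card_Diff_subset) presburger
  then obtain h where h: "bij_betw h D1 D2"
    using fin D1(2) finite_same_card_bij by metis
  have hD: "h d \<in> D" "d \<in> D" "h d \<notin> D1" "d \<noteq> h d" if "d \<in> D1" for d
    using bij_betwE[OF h] that D1(1) by (auto simp: D2_def)
  define P where "P d c = insert (line d c) (mirror_pairs d (h d) c)" for d c
  define C where "C = {P d c | d c. d \<in> D1 \<and> c < q}"
  define B where "B = \<Union>C"

  \<comment> \<open>Needed for disjointness of the classes: a block shared by two classes contains a
    pair to which \<open>unique\<close> applies.\<close>
  have big: "\<exists>u v. u \<in> b \<and> v \<in> b \<and> u \<noteq> v" if b: "b \<in> P d c" "d \<in> D1" "c < q" for b d c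
  proof (cases "b = line d c")
    case True
    then have "card b = q" using card_line[OF hD(2,1,4)[OF b(2)] b(3)] by simp
    then have "finite b" "\<not> card b \<le> Suc 0" using q(2) by (auto simp: card_ge_0_finite)
    then show ?thesis using card_le_Suc0_iff_eq by blast
  next
    case False
    then show ?thesis using b(1) by (auto simp: P_def mirror_pairs_def mirror_def)
  qed
  have through: "u \<in> X \<and> v \<in> X \<and> (b = line d c \<and> lam d u = c \<and> lam d v = c
      \<or> b = {u, v} \<and> lam (h d) u = lam (h d) v \<and> [lam d u + lam d v = 2 * c] (mod q))"
    if "b \<in> P d c" "u \<in> b" "v \<in> b" "u \<noteq> v" for b d c u v
    using that unfolding P_def mirror_pairs_def mirror_def line_def
    by (auto simp: add.commute)
  \<comment> \<open>The direction joining \<open>u\<close> and \<open>v\<close> is \<open>d\<close>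
    if the block is a line and \<open>h d\<close> if it is a pair. The mixed cases would place it in
    both halves. For two pairs, injectivity of \<open>h\<close> gives \<open>d = d'\<close>, and
    cancelling 2 modulo \<open>q\<close> gives \<open>c = c'\<close>. Recovering \<open>d\<close>
    and \<open>c\<close> along with the block also separates the classes.\<close>
  have unique: "b = b' \<and> d = d' \<and> c = c'"
    if uv: "u \<in> b" "v \<in> b" "u \<in> b'" "v \<in> b'" "u \<noteq> v"
      and b: "b \<in> P d c" "d \<in> D1" "c < q" and b': "b' \<in> P d' c'" "d' \<in> D1" "c' < q"
    for u v b b' d d' c c'
  proof -
    have X: "u \<in> X" "v \<in> X" using through[OF b(1) uv(1,2,5)] by auto
    note join = join_unique[OF X uv(5)]
    from through[OF b(1) uv(1,2,5)] through[OF b'(1) uv(3,4,5)] consider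
      (line_line) "b = line d c" "lam d u = c" "lam d v = c" "b' = line d' c'" "lam d' u = c'" "lam d' v = c'"
      | (line_pair) "lam d u = lam d v" "lam (h d') u = lam (h d') v"
      | (pair_line) "lam (h d) u = lam (h d) v" "lam d' u = lam d' v"
      | (pair_pair) "b = {u, v}" "lam (h d) u = lam (h d) v" "[lam d u + lam d v = 2 * c] (mod q)"
        "b' = {u, v}" "lam (h d') u = lam (h d') v" "[lam d' u + lam d' v = 2 * c'] (mod q)"
      by auto
    then show ?thesis
    proof cases
      case line_line
      then have "d = d'" using join[of d d'] hD b(2) b'(2) by simp
      with line_line show ?thesis by simp
    next
      case line_pair
      then have "d = h d'" using join[of d "h d'"] hD b(2) b'(2) by simp
      with hD(3)[OF b'(2)] b(2) show ?thesis by simp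
    next
      case pair_line
      then have "h d = d'" using join[of "h d" d'] hD b(2) b'(2) by simp
      with hD(3)[OF b(2)] b'(2) show ?thesis by simp
    next
      case pair_pair
      then have "h d = h d'" using join[of "h d" "h d'"] hD b(2) b'(2) by simp
      then have "d = d'" using h b(2) b'(2) by (auto simp: bij_betw_def dest: inj_onD)
      with pair_pair have "[2 * c = 2 * c'] (mod q)" by (metis cong_sym cong_trans)
      then have "c = c'" using cong_double_odd_iff[OF q(1) b(3) b'(3)] by simp
      with pair_pair \<open>d = d'\<close> show ?thesis by simp
    qed
  qed
  have exists: "\<exists>b d c. b \<in> P d c \<and> d \<in> D1 \<and> c < q \<and> u \<in> b \<and> v \<in> b"
    if uv: "u \<in> X" "v \<in> X" "u \<noteq> v" for u v
  proof -
    obtain e where e: "e \<in> D" "lam e u = lam e v" using ex1_join[OF uv] by blast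
    show ?thesis
    proof (cases "e \<in> D1")
      case True
      have "line e (lam e u) \<in> P e (lam e u)" "u \<in> line e (lam e u)" "v \<in> line e (lam e u)"
        using uv e by (simp_all add: P_def line_def)
      with True lam_less[OF e(1) uv(1)] show ?thesis by blast
    next
      case False
      with e(1) have "e \<in> D2" by (simp add: D2_def)
      then obtain d where d: "d \<in> D1" "e = h d" using h by (auto simp: bij_betw_def)
      \<comment> \<open>The axis passes through the midpoint: its index is half the sum of the two
        coordinates.\<close>
      obtain c where c: "c < q" "[lam d u + lam d v = 2 * c] (mod q)"
        using ex_half_mod_odd[OF q(1)] by blast
      have "{u, v} \<in> P d c"
        using uv e d c by (auto simp: P_def mirror_pairs_def mirror_def)
      with d c show ?thesis by blast
    qed
  qed
  have classes: "parallel_class X (P d c)"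
    "block_sizes (P d c) = add_mset q (replicate_mset ((q ^ 2 - q) div 2) 2)"
    if "d \<in> D1" "c < q" for d c
    unfolding P_def using parallel_class_mirror block_sizes_mirror hD[OF that(1)] that(2) q(1) by auto
  have "pairwise_balanced_design 1 X B"
    unfolding pairwise_balanced_design_def
  proof (intro conjI ballI impI)
    show "B \<subseteq> Pow X" using classes(1) by (fastforce simp: B_def C_def parallel_class_def)
    fix u v assume uv: "u \<in> X" "v \<in> X" "u \<noteq> v"
    from exists[OF uv] obtain b where b: "b \<in> B" "u \<in> b" "v \<in> b" unfolding B_def C_def by blast
    have "b' = b" if "b' \<in> B" "u \<in> b'" "v \<in> b'" for b'
      using b that unique uv(3) unfolding B_def C_def by blast
    with b have "{b \<in> B. u \<in> b \<and> v \<in> b} = {b}" by blast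
    then show "card {b \<in> B. u \<in> b \<and> v \<in> b} = 1" by simp
  qed (rule finite_X)
  moreover have "partition_on B C"
  proof (rule partition_onI)
    fix p p' assume "p \<in> C" "p' \<in> C" "p \<noteq> p'"
    then obtain d c d' c' where *: "p = P d c" "p' = P d' c'" "d \<in> D1" "d' \<in> D1" "c < q" "c' < q"
      unfolding C_def by blast
    show "disjnt p p'"
      unfolding disjnt_def
    proof (rule ccontr)
      assume "p \<inter> p' \<noteq> {}"
      then obtain b where b: "b \<in> P d c" "b \<in> P d' c'" using * by blast
      obtain u v where "u \<in> b" "v \<in> b" "u \<noteq> v" using big[OF b(1)] * by blast
      then have "d = d' \<and> c = c'" using unique[of u b v b d c d' c'] b * by blast
      with * \<open>p \<noteq> p'\<close> show False by simp
    qed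
  qed (auto simp: B_def C_def P_def)
  ultimately show ?thesis
    using classes unfolding curd_def has_class_partition_def C_def
    by (intro exI[of _ B] exI[of _ C]) (auto simp: C_def)
qed

end

section \<open>The affine plane over a finite field\<close>

text \<open>\<open>None\<close> is the vertical direction, where \<open>L\<close> gives the
  abscissa; \<open>Some m\<close> is slope \<open>m\<close>, where \<open>L\<close> gives the
  intercept. Points with different abscissas have the difference quotient as their only
  slope.\<close>

lemma (in field) ex1_line_through:
  assumes "x \<in> carrier R" "y \<in> carrier R" "x' \<in> carrier R" "y' \<in> carrier R" "(x, y) \<noteq> (x', y')"
  defines "L \<equiv> \<lambda>d (x, y). case d of None \<Rightarrow> x | Some m \<Rightarrow> y \<ominus> m \<otimes> x"
  shows "\<exists>!d. d \<in> insert None (Some ` carrier R) \<and> L d (x, y) = L d (x', y')"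
proof -
  have slope: "y \<ominus> m \<otimes> x = y' \<ominus> m \<otimes> x' \<longleftrightarrow> m \<otimes> (x \<ominus> x') = y \<ominus> y'" if "m \<in> carrier R" for m
  proof -
    have "y \<ominus> m \<otimes> x = y' \<ominus> m \<otimes> x' \<longleftrightarrow> (y \<ominus> m \<otimes> x) \<ominus> (y' \<ominus> m \<otimes> x') = \<zero>"
      using assms that by (intro r_right_minus_eq[symmetric]) auto
    also have "(y \<ominus> m \<otimes> x) \<ominus> (y' \<ominus> m \<otimes> x') = (y \<ominus> y') \<ominus> m \<otimes> (x \<ominus> x')"
      using assms that by algebra
    also have "\<dots> = \<zero> \<longleftrightarrow> y \<ominus> y' = m \<otimes> (x \<ominus> x')"
      using assms that by (intro r_right_minus_eq) auto
    finally show ?thesis by auto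
  qed
  show ?thesis
  proof (cases "x = x'")
    case True
    with assms have "y \<ominus> y' \<noteq> \<zero>" by simp
    then have "L (Some m) (x, y) \<noteq> L (Some m) (x', y')" if "m \<in> carrier R" for m
      using slope[OF that] that assms True by (simp add: L_def r_neg minus_eq)
    moreover have "L None (x, y) = L None (x', y')" using True by (simp add: L_def)
    ultimately show ?thesis by (intro ex1I[of _ None]) auto
  next
    case False
    then have "x \<ominus> x' \<noteq> \<zero>" using assms by simp
    then have unit: "x \<ominus> x' \<in> Units R" using assms by (simp add: field_Units)
    define m where "m = (y \<ominus> y') \<otimes> inv (x \<ominus> x')"
    have m: "m \<in> carrier R" using unit assms by (simp add: m_def)
    have "k \<otimes> (x \<ominus> x') = y \<ominus> y' \<longleftrightarrow> k = m" if "k \<in> carrier R" for k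
    proof
      assume "k \<otimes> (x \<ominus> x') = y \<ominus> y'"
      then have "m = k \<otimes> (x \<ominus> x') \<otimes> inv (x \<ominus> x')" by (simp add: m_def)
      also have "\<dots> = k" using unit assms that by (simp add: m_assoc)
      finally show "k = m" ..
    next
      assume "k = m"
      then show "k \<otimes> (x \<ominus> x') = y \<ominus> y'" using unit assms by (simp add: m_def m_assoc)
    qed
    then have "L (Some k) (x, y) = L (Some k) (x', y') \<longleftrightarrow> k = m" if "k \<in> carrier R" for k
      using slope that by (simp add: L_def)
    moreover have "L None (x, y) \<noteq> L None (x', y')" using False by (simp add: L_def)
    ultimately show ?thesis using m by (intro ex1I[of _ "Some m"]) auto
  qed
qed

text \<open>Points and field elements are numbered by arbitrary bijections \<open>pt\<close> and
  \<open>ix\<close>. This is harmless because \<open>ex1_join\<close> only compares coordinates for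
  equality.\<close>

lemma (in field) ex_affine_plane_coords:
  assumes fin: "finite (carrier R)"
  defines "q \<equiv> card (carrier R)"
  shows "\<exists>lam. affine_plane_coords {..<q ^ 2} (insert None (Some ` carrier R)) q lam"
proof -
  obtain ix where ix: "bij_betw ix (carrier R) {..<q}"
    using fin ex_bij_betw_finite_nat[OF fin] by (auto simp: q_def atLeast0LessThan)
  have "card {..<q ^ 2} = card (carrier R \<times> carrier R)"
    using fin by (simp add: q_def power2_eq_square card_cartesian_product)
  then obtain pt where pt: "bij_betw pt {..<q ^ 2} (carrier R \<times> carrier R)"
    using fin finite_same_card_bij[of "{..<q ^ 2}" "carrier R \<times> carrier R"] by auto
  define L where "L = (\<lambda>d (x, y). case d of None \<Rightarrow> x | Some m \<Rightarrow> y \<ominus> m \<otimes> x)"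
  have pt_in: "pt u \<in> carrier R \<times> carrier R" if "u < q ^ 2" for u
    using bij_betwE[OF pt] that by blast
  have L_in: "L d P \<in> carrier R" if "d \<in> insert None (Some ` carrier R)" "P \<in> carrier R \<times> carrier R" for d P
    using that by (auto simp: L_def)
  have "affine_plane_coords {..<q ^ 2} (insert None (Some ` carrier R)) q (\<lambda>d u. ix (L d (pt u)))"
  proof
    show "card (insert None (Some ` carrier R)) = q + 1"
      using fin by (simp add: q_def card_image)
    show "ix (L d (pt u)) < q" if "d \<in> insert None (Some ` carrier R)" "u \<in> {..<q ^ 2}" for d u
      using bij_betwE[OF ix] L_in[OF that(1) pt_in] that(2) by simp
    fix u v assume uv: "u \<in> {..<q ^ 2}" "v \<in> {..<q ^ 2}" "u \<noteq> v"
    obtain x y x' y' where xy: "pt u = (x, y)" "pt v = (x', y')" by (metis surj_pair)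
    have "pt u \<noteq> pt v" using pt uv by (auto simp: bij_betw_def dest: inj_onD)
    moreover have "pt u \<in> carrier R \<times> carrier R" "pt v \<in> carrier R \<times> carrier R"
      using pt_in uv by auto
    ultimately have "\<exists>!d. d \<in> insert None (Some ` carrier R) \<and> L d (pt u) = L d (pt v)"
      using ex1_line_through[of x y x' y'] by (simp add: xy L_def)
    moreover have "ix (L d (pt u)) = ix (L d (pt v)) \<longleftrightarrow> L d (pt u) = L d (pt v)"
      if d: "d \<in> insert None (Some ` carrier R)" for d
    proof -
      have "inj_on ix (carrier R)" using ix by (simp add: bij_betw_def)
      moreover have "L d (pt u) \<in> carrier R" "L d (pt v) \<in> carrier R"
        using L_in[OF d pt_in] uv by auto
      ultimately show ?thesis by (rule inj_on_eq_iff)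
    qed
    ultimately show "\<exists>!d. d \<in> insert None (Some ` carrier R) \<and> ix (L d (pt u)) = ix (L d (pt v))"
      by metis
  qed (use fin in auto)
  then show ?thesis by blast
qed

theorem theorem4p10:
  fixes p f q :: nat
  assumes "prime p" and "odd p" and "f > 0" and "q = p ^ f"
  shows "\<exists>(X :: nat set) B C.
           card X = q ^ 2 \<and>
           curd 1 X B C \<and>
           has_class_partition C (add_mset q (replicate_mset ((q ^ 2 - q) div 2) 2))"
proof -
  have q: "odd q" "q > 1"
    using assms one_less_power[OF prime_gt_1_nat[OF assms(1)] assms(3)] by simp_all
  obtain F :: "int poly set ring" where F: "field F" "card (carrier F) = q"
    using ex_finite_field assms(1,3,4) by blast
  \<comment> \<open>An infinite carrier would have cardinality 0.\<close>
  then have "finite (carrier F)" using q(2) by (metis card.infinite not_less_zero)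
  from field.ex_affine_plane_coords[OF F(1) this] obtain lam where
    "affine_plane_coords {..<q ^ 2} (insert None (Some ` carrier F)) q lam"
    unfolding F(2) by blast
  from affine_plane_coords.ex_curd[OF this q] show ?thesis
    by (intro exI[of _ "{..<q ^ 2}"]) simp
qed

end
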